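(* Let $k$ be a positive integer (support threshold), let $r$ be a positive integer and $\sigma$ a real number, and let $g$ be a (candidate) bipartite subgraph of a finite weighted bipartite graph $G_t$. Let $e_{u,v}\in E(g)$ and let $ub\_sup(e_{u,v})$ be any upper bound on the support $sup(e_{u,v})$ of $e_{u,v}$ in $g$. If $ub\_sup(e_{u,v})<k$, then $e_{u,v}$ can be safely pruned from $g$; that is, no subgraph $h\subseteq g$ that is a $(k,r,\sigma)$-bitruss contains the edge $e_{u,v}$.
   Context: A bipartite graph $G$ has two disjoint finite vertex sets $U(G)$ (users) and $L(G)$ (items), and edges $e_{u,v}\in E(G)$ with $u\in U(G)$, $v\in L(G)$; each edge carries a positive integer weight $w_{u,v}$. Subgraphs inherit edge weights. A butterfly $\Join(u_i,u_j,v_a,v_b)$ in a bipartite graph $g$ consists of two distinct users $u_i,u_j$ and two distinct items $v_a,v_b$ such that all four edges between them lie in $E(g)$. The support $sup(e)$ of an edge $e$ in $g$ is the number of butterflies of $g$ containing $e$. A wedge $\angle(u_i,v,u_j)$ in $g$ is a path $u_i - v - u_j$ in $g$ with $u_i\neq u_j$ users and $v$ an item; its weight is $\min\{w_{u_i,v},w_{u_j,v}\}$. The score of a butterfly is $w_{\Join(u_i,u_j,v_a,v_b)}=\min\{w_{u_i,v_a},w_{u_j,v_a}\}\cdot\min\{w_{u_i,v_b},w_{u_j,v_b}\}$. The user relationship score $score_{u_i,u_j}(g)$ is the sum of the scores of all butterflies of $g$ containing both $u_i$ and $u_j$ (each unordered pair $\{v_a,v_b\}$ counted once). A $(k,r,\sigma)$-bitruss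 is a connected bipartite subgraph $h$ of $G_t$ together with a center user $u_c\in U(h)$ such that: (Support) every edge of $h$ has support at least $k$ in $h$; (Radius) every user $u_i\in U(h)$ satisfies $dist(u_c,u_i)\le 2r$, where $dist$ is shortest-path distance (number of edges) in $h$; (Score) for every wedge $\angle(u_i,v,u_j)$ in $h$, $score_{u_i,u_j}(h)\ge\sigma$. *)

theory Defs
  imports "Graph_Theory.Graph_Theory"
begin

record 'a pre_wbigraph =
  users :: "'a set"
  items :: "'a set"
  edges :: "('a \<times> 'a) set"
  weight :: "'a \<times> 'a \<Rightarrow> nat"

text \<open>An edge is a pair (user, item). Only the weights of edges are meaningful.\<close>

locale wbigraph =
  fixes G :: "'a pre_wbigraph"
  assumes finite_users: "finite (users G)"
    and finite_items: "finite (items G)"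
    and disjoint: "users G \<inter> items G = {}"
    and edges_subset: "edges G \<subseteq> users G \<times> items G"
    and weight_pos: "\<And>e. e \<in> edges G \<Longrightarrow> weight G e > 0"

definition bisubgraph :: "'a pre_wbigraph \<Rightarrow> 'a pre_wbigraph \<Rightarrow> bool" where
  "bisubgraph H G \<longleftrightarrow> wbigraph H \<and> wbigraph G \<and>
     users H \<subseteq> users G \<and> items H \<subseteq> items G \<and> edges H \<subseteq> edges G \<and>
     (\<forall>e \<in> edges H. weight H e = weight G e)"

text \<open>The underlying undirected graph, as a symmetric digraph: every edge gives
  an arc in both directions.\<close>

definition underlying :: "'a pre_wbigraph \<Rightarrow> 'a pair_pre_digraph" where
  "underlying G = \<lparr>pverts = users G \<union> items G, parcs = edges G \<union> (edges G)\<inverse>\<rparr>"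

definition connected_bigraph :: "'a pre_wbigraph \<Rightarrow> bool" where
  "connected_bigraph G \<longleftrightarrow> Digraph_Component.connected (with_proj (underlying G))"

text \<open>Number of edges of a shortest path; it is infinite if there is no path.\<close>

definition dist_in :: "'a pre_wbigraph \<Rightarrow> 'a \<Rightarrow> 'a \<Rightarrow> ereal" where
  "dist_in G x y = wf_digraph.\<mu> (with_proj (underlying G)) (\<lambda>_. 1) x y"

definition is_butterfly :: "'a pre_wbigraph \<Rightarrow> 'a \<Rightarrow> 'a \<Rightarrow> 'a \<Rightarrow> 'a \<Rightarrow> bool" where
  "is_butterfly G ui uj va vb \<longleftrightarrow>
     ui \<in> users G \<and> uj \<in> users G \<and> va \<in> items G \<and> vb \<in> items G \<and> ui \<noteq> uj \<and> va \<noteq> vb \<and>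
     (ui, va) \<in> edges G \<and> (ui, vb) \<in> edges G \<and> (uj, va) \<in> edges G \<and> (uj, vb) \<in> edges G"

text \<open>To count each butterfly once, irrespective of the order of its two users and of its
  two items, it is identified with the pair of its user set and its item set. Its edge set is
  then the product of the two.\<close>

definition butterflies :: "'a pre_wbigraph \<Rightarrow> ('a set \<times> 'a set) set" where
  "butterflies G = {({ui, uj}, {va, vb}) | ui uj va vb. is_butterfly G ui uj va vb}"

definition support :: "'a pre_wbigraph \<Rightarrow> 'a \<times> 'a \<Rightarrow> nat" where
  "support G e = card {B \<in> butterflies G. e \<in> fst B \<times> snd B}"

definition wedge :: "'a pre_wbigraph \<Rightarrow> 'a \<Rightarrow> 'a \<Rightarrow> 'a \<Rightarrow> bool" where
  "wedge G ui v uj \<longleftrightarrow> ui \<in> users G \<and> uj \<in> users G \<and> v \<in> items G \<and> ui \<noteq> uj \<and>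
     (ui, v) \<in> edges G \<and> (uj, v) \<in> edges G"

definition butterfly_score :: "'a pre_wbigraph \<Rightarrow> 'a set \<times> 'a set \<Rightarrow> nat" where
  "butterfly_score G B = (\<Prod>v \<in> snd B. Min ((\<lambda>u. weight G (u, v)) ` fst B))"

lemma butterfly_score_eq:
  assumes "is_butterfly G ui uj va vb"
  shows "butterfly_score G ({ui, uj}, {va, vb}) =
    min (weight G (ui, va)) (weight G (uj, va)) * min (weight G (ui, vb)) (weight G (uj, vb))"
  using assms by (simp add: butterfly_score_def is_butterfly_def)

definition user_score :: "'a pre_wbigraph \<Rightarrow> 'a \<Rightarrow> 'a \<Rightarrow> nat" where
  "user_score G ui uj = (\<Sum>B \<in> {B \<in> butterflies G. ui \<in> fst B \<and> uj \<in> fst B}. butterfly_score G B)"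

definition bitruss ::
  "'a pre_wbigraph \<Rightarrow> nat \<Rightarrow> nat \<Rightarrow> real \<Rightarrow> 'a pre_wbigraph \<Rightarrow> 'a \<Rightarrow> bool" where
  "bitruss Gt k r \<sigma> h uc \<longleftrightarrow>
     bisubgraph h Gt \<and> connected_bigraph h \<and> uc \<in> users h \<and>
     (\<forall>e \<in> edges h. support h e \<ge> k) \<and>
     (\<forall>ui \<in> users h. dist_in h uc ui \<le> ereal (2 * real r)) \<and>
     (\<forall>ui v uj. wedge h ui v uj \<longrightarrow> real (user_score h ui uj) \<ge> \<sigma>)"

lemma (in wbigraph) wf_underlying: "wf_digraph (with_proj (underlying G))"
  by unfold_locales (use edges_subset in \<open>auto simp: underlying_def\<close>)

lemma (in wbigraph) dist_in_eq:
  "dist_in G x y = (INF p \<in> {p. pre_digraph.awalk (with_proj (underlying G)) x p y}. ereal (real (length p)))"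
proof -
  interpret D: wf_digraph "with_proj (underlying G)" by (rule wf_underlying)
  show ?thesis
    by (simp add: dist_in_def D.\<mu>_def D.awalk_cost_def sum_list_triv)
qed

end

theory Submission
  imports Defs
begin

text \<open>Support can only drop when passing to a subgraph: a butterfly of h uses only edges of h,
  so it is also a butterfly of g. An edge of a bitruss h inside g would thus have support at least k
  already in g, which an upper bound below k excludes. The argument rests on
  \<open>butterflies_mono\<close> and \<open>support_mono\<close>.\<close>

lemma is_butterfly_mono:
  "bisubgraph H G \<Longrightarrow> is_butterfly H ui uj va vb \<Longrightarrow> is_butterfly G ui uj va vb"
  by (simp add: bisubgraph_def is_butterfly_def subset_iff)

lemma butterflies_mono:
  assumes "bisubgraph H G"
  shows "butterflies H \<subseteq> butterflies G"
proof
  fix B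
  assume "B \<in> butterflies H"
  then obtain ui uj va vb where "B = ({ui, uj}, {va, vb})" "is_butterfly H ui uj va vb"
    unfolding butterflies_def by (elim CollectE exE conjE)
  with is_butterfly_mono[OF assms] show "B \<in> butterflies G"
    unfolding butterflies_def by (intro CollectI exI conjI)
qed

text \<open>Needed to compare supports: \<open>card\<close> is 0 on infinite sets, so it is monotone
  only below a finite set.\<close>

lemma (in wbigraph) finite_butterflies: "finite (butterflies G)"
proof (rule finite_subset)
  show "butterflies G \<subseteq> Pow (users G) \<times> Pow (items G)"
  proof
    fix B
    assume "B \<in> butterflies G"
    then obtain ui uj va vb where "B = ({ui, uj}, {va, vb})" "is_butterfly G ui uj va vb"
      unfolding butterflies_def by (elim CollectE exE conjE)
    then show "B \<in> Pow (users G) \<times> Pow (items G)"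
      by (simp add: is_butterfly_def)
  qed
  show "finite (Pow (users G) \<times> Pow (items G))"
    using finite_users finite_items by simp
qed

text \<open>Whether a butterfly B contains e depends on B alone, not on the surrounding graph, so
  the inclusion of butterflies survives restriction to those through e.\<close>

lemma support_mono:
  assumes "bisubgraph H G"
  shows "support H e \<le> support G e"
proof -
  interpret wbigraph G
    using assms by (simp add: bisubgraph_def)
  show ?thesis
    unfolding support_def
    using finite_butterflies butterflies_mono[OF assms]
    by (intro card_mono) (simp_all add: subset_iff)
qed

theorem lemma2:
  fixes Gt g :: "'a pre_wbigraph" and k r :: nat and \<sigma> ub_sup :: real and u v :: 'a
  assumes "k > 0" and "r > 0"
    and "wbigraph Gt" and "bisubgraph g Gt"
    and "(u, v) \<in> edges g"
    and "real (support g (u, v)) \<le> ub_sup"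
    and "ub_sup < real k"
  shows "\<not> (\<exists>h uc. bisubgraph h g \<and> bitruss Gt k r \<sigma> h uc \<and> (u, v) \<in> edges h)"
proof (intro notI, elim exE conjE)
  fix h uc
  assume sub: "bisubgraph h g" and "bitruss Gt k r \<sigma> h uc" and "(u, v) \<in> edges h"
  then have "k \<le> support h (u, v)"
    by (simp add: bitruss_def)
  also have "\<dots> \<le> support g (u, v)"
    using sub by (rule support_mono)
  \<comment> \<open>The chain closes as k \<le> \<open>support g (u, v)\<close> \<le>
    \<open>ub_sup\<close> < k, read in the reals.\<close>
  finally show False
    using assms(6,7) by linarith
qed

end
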